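(* Let $S, S', T, T'$ be statements and $B$ a Boolean program expression, with types such that all the expressions below are well-typed and partial refinement applies (exceptional state space equal to initial state space). Then: (i) if $S \precsim S'$ then $S;T \precsim S';T$; (ii) if $S \precsim S'$ and $T \precsim T'$ then $S \sqcap T \precsim S' \sqcap T'$ and $\mathsf{if}\ B\ \mathsf{then}\ S\ \mathsf{else}\ T \precsim \mathsf{if}\ B\ \mathsf{then}\ S'\ \mathsf{else}\ T'$.
   Context: A state predicate on a state space is a function to $Bool$; logical operations are pointwise and $u\le v$ iff $\forall\sigma.\ u\,\sigma\Rightarrow v\,\sigma$. A predicate transformer of type $\mathcal P\Psi\times\mathcal P\Omega\to\mathcal P\Delta$ maps a normal postcondition on $\Psi$ and an exceptional postcondition on $\Omega$ to a precondition on $\Delta$; a statement is a monotonic one ($q\le q'$, $r\le r'$ imply $S(q,r)\le S(q',r')$). Definitions: $\mathsf{raise}(q,r)=r$, $(S;T)(q,r)=S(T(q,r),r)$, $(S\sqcap T)(q,r)=S(q,r)\wedge T(q,r)$, $[u,v](q,r)=(u\Rightarrow q)\wedge(v\Rightarrow r)$, $[u](q,r)=(u\Rightarrow q)$. A Boolean program expression $B$ has a definedness predicate $\mathsf{def}\,B$ and value predicate $\mathsf{val}\,B$; $\mathsf{if}\ B\ \mathsf{then}\ S\ \mathsf{else}\ T = [\mathsf{def}\,B,\neg\mathsf{def}\,B];(([\mathsf{val}\,B];S)\sqcap([\neg\mathsf{val}\,B];T))$. Total refinement $S\sqsubseteq T$ iff $\forall q,r.\ S(q,r)\le T(q,r)$.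 Partial refinement (for transformers whose exceptional state space equals their initial state space): $S\precsim T \;\widehat=\; S\sqcap\mathsf{raise}\sqsubseteq T$. *)

theory Defs
  imports Main
begin

type_synonym 's pred = "'s \<Rightarrow> bool"

definition pred_imp :: "'s pred \<Rightarrow> 's pred \<Rightarrow> 's pred"  (infixr "\<rightarrow>\<^sub>p" 60) where
  "u \<rightarrow>\<^sub>p v = (\<lambda>\<sigma>. u \<sigma> \<longrightarrow> v \<sigma>)"

text \<open>
  The type arguments are, in this order, the normal final, the exceptional final and the
  initial state space.  The pointwise order, conjunction and negation of predicates are
  the library's \<open>\<le>\<close>, \<open>inf\<close> and unary minus on functions into \<open>bool\<close>.
\<close>

type_synonym ('p, 'o, 'd) ptrans = "'p pred \<times> 'o pred \<Rightarrow> 'd pred"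

definition statement :: "('p, 'o, 'd) ptrans \<Rightarrow> bool" where
  "statement S \<longleftrightarrow> (\<forall>q q' r r'. q \<le> q' \<longrightarrow> r \<le> r' \<longrightarrow> S (q, r) \<le> S (q', r'))"

definition raise :: "('p, 'd, 'd) ptrans" where
  "raise = (\<lambda>(q, r). r)"

definition seq_comp :: "('p, 'o, 'd) ptrans \<Rightarrow> ('x, 'o, 'p) ptrans \<Rightarrow> ('x, 'o, 'd) ptrans"
    (infixr "\<^bold>;" 75) where
  "S \<^bold>; T = (\<lambda>(q, r). S (T (q, r), r))"

definition demonic :: "('p, 'o, 'd) ptrans \<Rightarrow> ('p, 'o, 'd) ptrans \<Rightarrow> ('p, 'o, 'd) ptrans"
    (infixl "\<sqinter>" 70) where
  "S \<sqinter> T = (\<lambda>(q, r). inf (S (q, r)) (T (q, r)))"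

text \<open>The transformers \<open>[u, v]\<close> and \<open>[u]\<close>.\<close>

definition assume_exc :: "'d pred \<Rightarrow> 'd pred \<Rightarrow> ('d, 'd, 'd) ptrans" where
  "assume_exc u v = (\<lambda>(q, r). inf (u \<rightarrow>\<^sub>p q) (v \<rightarrow>\<^sub>p r))"

definition assume_norm :: "'d pred \<Rightarrow> ('d, 'o, 'd) ptrans" where
  "assume_norm u = (\<lambda>(q, r). u \<rightarrow>\<^sub>p q)"

text \<open>
  A Boolean program expression enters only through its definedness and value predicates;
  nothing is assumed about the value where the expression is undefined.
\<close>

record 'd bexpr =
  bdef :: "'d pred"
  bval :: "'d pred"

definition if_stmt :: "'d bexpr \<Rightarrow> ('p, 'd, 'd) ptrans \<Rightarrow> ('p, 'd, 'd) ptrans \<Rightarrow> ('p, 'd, 'd) ptrans" where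
  "if_stmt B S T =
     assume_exc (bdef B) (- bdef B) \<^bold>;
       ((assume_norm (bval B) \<^bold>; S) \<sqinter> (assume_norm (- bval B) \<^bold>; T))"

definition refines :: "('p, 'o, 'd) ptrans \<Rightarrow> ('p, 'o, 'd) ptrans \<Rightarrow> bool"  (infix "\<sqsubseteq>" 50) where
  "S \<sqsubseteq> T \<longleftrightarrow> (\<forall>q r. S (q, r) \<le> T (q, r))"

definition partially_refines :: "('p, 'd, 'd) ptrans \<Rightarrow> ('p, 'd, 'd) ptrans \<Rightarrow> bool"
    (infix "\<lesssim>" 50) where
  "S \<lesssim> T \<longleftrightarrow> S \<sqinter> raise \<sqsubseteq> T"

end

theory Submission
  imports Defs
begin

text \<open>Partial refinement is a statewise implication between preconditions, required only at
  initial states satisfying the exceptional postcondition \<open>r\<close>. Each construct here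
  hands the same \<open>r\<close> to its refined components and evaluates them at the same initial
  state, so the side condition \<open>r \<sigma>\<close> carries over unchanged and the implications
  combine state by state.\<close>

lemma partially_refines_iff:
  "S \<lesssim> S' \<longleftrightarrow> (\<forall>q r \<sigma>. S (q, r) \<sigma> \<longrightarrow> r \<sigma> \<longrightarrow> S' (q, r) \<sigma>)"
  by (auto simp: partially_refines_def refines_def demonic_def raise_def le_fun_def)

text \<open>The hypothesis holds for every normal postcondition, in particular for
  \<open>T (q, r)\<close>, with \<open>r\<close> kept.\<close>

lemma seq_comp_partially_refines:
  assumes "S \<lesssim> S'"
  shows "S \<^bold>; T \<lesssim> S' \<^bold>; T"
  using assms by (simp add: partially_refines_iff seq_comp_def)

lemma demonic_partially_refines:
  assumes "S \<lesssim> S'" "T \<lesssim> T'"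
  shows "S \<sqinter> T \<lesssim> S' \<sqinter> T'"
  using assms by (simp add: partially_refines_iff demonic_def)

text \<open>At a single state, an assumption whose guard fails is vacuously true, so exactly one of
  three obligations survives: a branch, or \<open>r\<close> itself where \<open>B\<close> is
  undefined. This makes monotonicity of the conditional a case split, trivial in the undefined
  case.\<close>

lemma if_stmt_apply:
  "if_stmt B S T (q, r) \<sigma> \<longleftrightarrow>
     (if bdef B \<sigma> then if bval B \<sigma> then S (q, r) \<sigma> else T (q, r) \<sigma> else r \<sigma>)"
  by (simp add: if_stmt_def seq_comp_def demonic_def assume_exc_def assume_norm_def pred_imp_def)

lemma if_stmt_partially_refines:
  assumes "S \<lesssim> S'" "T \<lesssim> T'"
  shows "if_stmt B S T \<lesssim> if_stmt B S' T'"
  using assms by (simp add: partially_refines_iff if_stmt_apply)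

theorem theorem8:
  shows
    "(\<forall>(S :: ('p, 'd, 'd) ptrans) (S' :: ('p, 'd, 'd) ptrans) (T :: ('x, 'd, 'p) ptrans).
        statement S \<and> statement S' \<and> statement T \<longrightarrow>
        S \<lesssim> S' \<longrightarrow> S \<^bold>; T \<lesssim> S' \<^bold>; T) \<and>
     (\<forall>(S :: ('p, 'd, 'd) ptrans) (S' :: ('p, 'd, 'd) ptrans)
        (T :: ('p, 'd, 'd) ptrans) (T' :: ('p, 'd, 'd) ptrans) (B :: 'd bexpr).
        statement S \<and> statement S' \<and> statement T \<and> statement T' \<longrightarrow>
        S \<lesssim> S' \<and> T \<lesssim> T' \<longrightarrow>
        S \<sqinter> T \<lesssim> S' \<sqinter> T' \<and> if_stmt B S T \<lesssim> if_stmt B S' T')"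
  by (blast intro: seq_comp_partially_refines demonic_partially_refines if_stmt_partially_refines)

end
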